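(* If $x = 70 = 2 \cdot 5 \cdot 7 \in M_{4,6}$, then $\ell_0^M(x^n) \in \Theta(n^{2/3})$ as a function of $n \ge 1$.
   Context: $M_{4,6} = \{1\} \cup \{n \in \mathbb{Z}_{\ge 1} : n \equiv 4 \bmod 6\}$, a multiplicative submonoid of $\mathbb{Z}_{\ge 1}$ (an arithmetical congruence monoid). An atom of $M_{4,6}$ is an irreducible element: an element $u \ne 1$ of $M_{4,6}$ that is not a product of two elements of $M_{4,6} \setminus \{1\}$. For $x \in M_{4,6}$, the set of factorization tuples of $x$ is $\mathsf{Z}(x) = \{\mathbf{z} \in \mathbb{Z}_{\ge 0}^k : x = u_1^{z_1} \cdots u_k^{z_k} \text{ for some } k \ge 0 \text{ and distinct atoms } u_1, \ldots, u_k \in M_{4,6}\}$. For a tuple $\mathbf{z} = (z_1, \ldots, z_k)$, let $\ell_0(\mathbf{z})$ be the number of nonzero entries of $\mathbf{z}$ (i.e. $z_1^0 + \cdots + z_k^0$ with the convention $0^0 = 0$). Let $\ell_0^M(x) = \max\{\ell_0(\mathbf{z}) : \mathbf{z} \in \mathsf{Z}(x)\}$, i.e. the maximum number of distinct atoms occurring in a factorization of $x$ (the superscript $M$ stands for maximum and is not an exponent). *)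

theory Defs
  imports Complex_Main "HOL-Number_Theory.Cong" "HOL-Library.Landau_Symbols"
begin

definition M46 :: "nat set" where
  "M46 = {1} \<union> {n. n \<ge> 1 \<and> [n = 4] (mod 6)}"

definition atoms46 :: "nat set" where
  "atoms46 = {u \<in> M46. u \<noteq> 1 \<and> \<not> (\<exists>a \<in> M46 - {1}. \<exists>b \<in> M46 - {1}. u = a * b)}"

text \<open>
  A tuple in \<open>\<nat>\<^sup>k\<close> is a list of length \<open>k\<close>. Zero exponents are allowed, so the set of
  factorization tuples of an element is infinite: any tuple can be padded with zeros.
\<close>

definition factorization_tuples :: "nat \<Rightarrow> nat list set" where
  "factorization_tuples x =
    {z. \<exists>us. length us = length z \<and> distinct us \<and> set us \<subseteq> atoms46 \<and>
          x = (\<Prod>i<length z. (us ! i) ^ (z ! i))}"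

definition ell0 :: "nat list \<Rightarrow> nat" where
  "ell0 z = card {i. i < length z \<and> z ! i \<noteq> 0}"

text \<open>
  The superscript in \<open>\<ell>\<^sub>0\<^sup>M\<close> stands for maximum. The maximum is over a finite set, and over a
  nonempty one for every element of \<^const>\<open>M46\<close>; see \<open>finite_ell0_image\<close> and
  \<open>factorization_tuples_nonempty\<close>.
\<close>

definition ell0_max :: "nat \<Rightarrow> nat" where
  "ell0_max x = Max (ell0 ` factorization_tuples x)"

lemma one_in_M46: "1 \<in> M46"
  by (simp add: M46_def)

lemma mult_in_M46: "a \<in> M46 \<Longrightarrow> b \<in> M46 \<Longrightarrow> a * b \<in> M46"
  by (auto simp: M46_def cong_def mod_mult_eq [of a 6 b, symmetric])

lemma seventy_in_M46: "70 \<in> M46"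
  by (simp add: M46_def cong_def)

lemma ell0_le:
  assumes "z \<in> factorization_tuples x"
  shows "ell0 z \<le> x"
proof -
  obtain us where us: "length us = length z" "set us \<subseteq> atoms46"
    and x: "x = (\<Prod>i<length z. (us ! i) ^ (z ! i))"
    using assms by (auto simp: factorization_tuples_def)
  have ge2: "us ! i \<ge> 2" if "i < length z" for i
  proof -
    have "us ! i \<in> atoms46" using us that by (metis nth_mem subsetD)
    then show ?thesis by (auto simp: atoms46_def M46_def)
  qed
  have "ell0 z < 2 ^ ell0 z" by (rule less_exp)
  also have "\<dots> = (\<Prod>i \<in> {i. i < length z \<and> z ! i \<noteq> 0}. 2)" by (simp add: ell0_def)
  also have "\<dots> = (\<Prod>i<length z. if z ! i \<noteq> 0 then 2 else 1)"
    by (subst prod.inter_filter [symmetric]) (auto intro: prod.cong)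
  also have "\<dots> \<le> x"
    unfolding x
  proof (rule prod_mono, intro conjI)
    fix i assume i: "i \<in> {..<length z}"
    show "(if z ! i \<noteq> 0 then 2 else 1) \<le> (us ! i) ^ (z ! i)"
    proof (cases "z ! i = 0")
      case False
      have "2 \<le> us ! i" using ge2 i by auto
      also have "us ! i \<le> (us ! i) ^ (z ! i)"
        using False ge2 [of i] i by (intro self_le_power) auto
      finally show ?thesis using False by simp
    qed simp
  qed auto
  finally show ?thesis by simp
qed

lemma finite_ell0_image: "finite (ell0 ` factorization_tuples x)"
  by (rule finite_subset [of _ "{..x}"]) (auto dest: ell0_le)

lemma factorization_tuples_nonempty:
  assumes "x \<in> M46"
  shows "factorization_tuples x \<noteq> {}"
proof -
  have "\<exists>f. finite {u. f u \<noteq> (0::nat)} \<and> {u. f u \<noteq> 0} \<subseteq> atoms46 \<and>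
          x = (\<Prod>u | f u \<noteq> 0. u ^ f u)"
    using assms
  proof (induction x rule: less_induct)
    case (less x)
    consider "x = 1" | "x \<in> atoms46" | a b where "a \<in> M46 - {1}" "b \<in> M46 - {1}" "x = a * b"
      using less.prems by (auto simp: atoms46_def)
    then show ?case
    proof cases
      case 1
      then show ?thesis by (intro exI [of _ "\<lambda>_. 0"]) auto
    next
      case 2
      then show ?thesis by (intro exI [of _ "\<lambda>u. if u = x then 1 else 0"]) auto
    next
      case 3
      then have gt: "a > 1" "b > 1" by (auto simp: M46_def)
      then have "a < x" "b < x" using 3 by auto
      then obtain f g where
        f: "finite {u. f u \<noteq> (0::nat)}" "{u. f u \<noteq> 0} \<subseteq> atoms46" "a = (\<Prod>u | f u \<noteq> 0. u ^ f u)"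
        and g: "finite {u. g u \<noteq> (0::nat)}" "{u. g u \<noteq> 0} \<subseteq> atoms46" "b = (\<Prod>u | g u \<noteq> 0. u ^ g u)"
        using less.IH [of a] less.IH [of b] 3 by blast
      let ?S = "{u. f u + g u \<noteq> 0}"
      have S: "?S = {u. f u \<noteq> 0} \<union> {u. g u \<noteq> 0}" by auto
      have finS: "finite ?S" unfolding S using f g by blast
      have "a = (\<Prod>u\<in>?S. u ^ f u)" unfolding f(3)
        by (rule prod.mono_neutral_left [OF finS]) auto
      moreover have "b = (\<Prod>u\<in>?S. u ^ g u)" unfolding g(3)
        by (rule prod.mono_neutral_left [OF finS]) auto
      ultimately have "x = (\<Prod>u\<in>?S. u ^ (f u + g u))"
        using 3 by (simp add: power_add prod.distrib)
      moreover have "?S \<subseteq> atoms46" unfolding S using f g by blast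
      ultimately show ?thesis using finS by (intro exI [of _ "\<lambda>u. f u + g u"]) blast
    qed
  qed
  then obtain f where f: "finite {u. f u \<noteq> (0::nat)}" "{u. f u \<noteq> 0} \<subseteq> atoms46"
      "x = (\<Prod>u | f u \<noteq> 0. u ^ f u)" by blast
  obtain us where us: "set us = {u. f u \<noteq> 0}" "distinct us"
    using finite_distinct_list [OF f(1)] by blast
  have "x = (\<Prod>u\<in>set us. u ^ f u)" using f us by simp
  also have "\<dots> = (\<Prod>i<length us. (us ! i) ^ f (us ! i))"
    by (rule prod.reindex_bij_betw [symmetric]) (rule bij_betw_nth [OF us(2)], auto)
  finally have "map f us \<in> factorization_tuples x"
    using us f by (auto simp: factorization_tuples_def intro!: exI [of _ us])
  then show ?thesis by blast
qed

end

theory Submission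
  imports Defs
begin

text \<open>
  An element \<open>2\<^sup>a 5\<^sup>b 7\<^sup>c \<noteq> 1\<close> belongs to the monoid iff \<open>a \<ge> 1\<close> and \<open>a + b\<close> is even. It is an
  atom if \<open>a = 1\<close>, and it is not an atom if \<open>a \<ge> 3\<close>, because then \<open>4\<close> splits off.

  Upper bound: for every \<open>t\<close>, at most \<open>3t\<^sup>2\<close> atoms have \<open>b, c < t\<close>, and in a factorization of
  \<open>70\<^sup>n\<close> at most \<open>2n/t\<close> distinct atoms have \<open>b \<ge> t\<close> or \<open>c \<ge> t\<close>, because the \<open>b\<close> and the \<open>c\<close> each
  sum up to at most \<open>n\<close>. Take \<open>t\<close> near \<open>n\<^sup>1\<^sup>/\<^sup>3\<close>.

  Lower bound: the \<open>m\<^sup>2\<close> atoms \<open>2 \<cdot> 5\<^sup>2\<^sup>i\<^sup>+\<^sup>1 \<cdot> 7\<^sup>j\<close> with \<open>i, j < m\<close> have a product dividing \<open>70\<^sup>n\<close>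
  within the monoid as soon as \<open>2 \<le> m\<close> and \<open>m\<^sup>3 \<le> n\<close>.
\<close>

section \<open>Factorizations indexed by sets of atoms\<close>

text \<open>Dropping the zero entries, which a tuple may carry in any number, leaves an exponent
  function on a set of atoms. Later counting then works with sets alone.\<close>

lemma factorization_tuplesE:
  assumes "z \<in> factorization_tuples x"
  obtains S f where "finite S" "S \<subseteq> atoms46" "card S = ell0 z" "\<And>u. u \<in> S \<Longrightarrow> f u > 0"
    "x = (\<Prod>u\<in>S. u ^ f u)"
proof -
  obtain us where us: "length us = length z" "distinct us" "set us \<subseteq> atoms46"
    and x: "x = (\<Prod>i<length z. (us ! i) ^ (z ! i))"
    using assms by (auto simp: factorization_tuples_def)
  define I where "I = {i. i < length z \<and> z ! i \<noteq> 0}"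
  have inj: "inj_on ((!) us) I"
    using us by (auto simp: I_def inj_on_def nth_eq_iff_index_eq)
  define f where "f u = z ! the_inv_into I ((!) us) u" for u
  have f: "f (us ! i) = z ! i" if "i \<in> I" for i
    using inj that by (simp add: f_def the_inv_into_f_f)
  have "x = (\<Prod>i\<in>I. (us ! i) ^ (z ! i))"
    unfolding x I_def by (rule prod.mono_neutral_right) auto
  also have "\<dots> = (\<Prod>u\<in>(!) us ` I. u ^ f u)"
    by (simp add: prod.reindex [OF inj] f)
  finally have x: "x = (\<Prod>u\<in>(!) us ` I. u ^ f u)" .
  show thesis
  proof (rule that [OF _ _ _ _ x])
    show "finite ((!) us ` I)" by (simp add: I_def)
    show "(!) us ` I \<subseteq> atoms46" using us by (auto simp: I_def)
    show "card ((!) us ` I) = ell0 z" using card_image [OF inj] by (simp add: I_def ell0_def)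
    show "f u > 0" if "u \<in> (!) us ` I" for u using that f by (auto simp: I_def)
  qed
qed

lemma card_le_ell0_max:
  assumes "finite S" "S \<subseteq> atoms46" "\<And>u. u \<in> S \<Longrightarrow> f u > 0"
  shows "card S \<le> ell0_max (\<Prod>u\<in>S. u ^ f u)"
proof -
  obtain us where us: "set us = S" "distinct us"
    using finite_distinct_list [OF assms(1)] by blast
  have "(\<Prod>u\<in>S. u ^ f u) = (\<Prod>i<length us. (us ! i) ^ f (us ! i))"
    by (rule prod.reindex_bij_betw [symmetric]) (rule bij_betw_nth [OF us(2)], auto simp: us)
  then have "map f us \<in> factorization_tuples (\<Prod>u\<in>S. u ^ f u)"
    using us assms by (auto simp: factorization_tuples_def intro!: exI [of _ us])
  then have "ell0 (map f us) \<le> ell0_max (\<Prod>u\<in>S. u ^ f u)"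
    unfolding ell0_max_def by (intro Max_ge finite_ell0_image) blast
  moreover have "{i. i < length (map f us) \<and> map f us ! i \<noteq> 0} = {..<length us}"
    using assms(3) us nth_mem by fastforce
  then have "ell0 (map f us) = card S"
    using distinct_card [OF us(2)] us by (simp only: ell0_def) simp
  ultimately show ?thesis by simp
qed

text \<open>Any factorization of the cofactor \<open>r\<close> can be merged in, and this only
  enlarges the support. So the lower bound never has to factor \<open>r\<close> explicitly.\<close>

lemma card_le_ell0_max_mult:
  assumes S: "finite S" "S \<subseteq> atoms46" and r: "r \<in> M46"
  shows "card S \<le> ell0_max (\<Prod>S * r)"
proof -
  obtain z where "z \<in> factorization_tuples r"
    using factorization_tuples_nonempty [OF r] by blast
  then obtain T g where T: "finite T" "T \<subseteq> atoms46" "\<And>u. u \<in> T \<Longrightarrow> g u > 0"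
    and req: "r = (\<Prod>u\<in>T. u ^ g u)"
    by (rule factorization_tuplesE) blast
  \<comment> \<open>\<open>g\<close> is arbitrary off \<open>T\<close>, hence the guard; an atom in
    both sets receives both exponents.\<close>
  define f where "f u = (if u \<in> S then 1 else 0) + (if u \<in> T then g u else 0)" for u
  have "(\<Prod>u\<in>S \<union> T. u ^ f u) =
      (\<Prod>u\<in>S \<union> T. u ^ (if u \<in> S then 1 else 0)) * (\<Prod>u\<in>S \<union> T. u ^ (if u \<in> T then g u else 0))"
    by (simp add: f_def power_add prod.distrib)
  also have "(\<Prod>u\<in>S \<union> T. u ^ (if u \<in> S then 1 else 0)) = \<Prod>S"
    using S T by (intro prod.mono_neutral_cong_right) auto
  also have "(\<Prod>u\<in>S \<union> T. u ^ (if u \<in> T then g u else 0)) = r"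
    unfolding req using S T by (intro prod.mono_neutral_cong_right) auto
  finally have eq: "(\<Prod>u\<in>S \<union> T. u ^ f u) = \<Prod>S * r" .
  have "card S \<le> card (S \<union> T)" using S T by (intro card_mono) auto
  also have "\<dots> \<le> ell0_max (\<Prod>u\<in>S \<union> T. u ^ f u)"
    using S T by (intro card_le_ell0_max) (auto simp: f_def)
  finally show ?thesis by (simp add: eq)
qed

section \<open>Atoms\<close>

lemma M46_iff: "u \<in> M46 \<longleftrightarrow> u = 1 \<or> even u \<and> u mod 3 = 1"
proof -
  have "u mod 6 = 4 \<longleftrightarrow> even u \<and> u mod 3 = 1" by presburger
  then show ?thesis by (auto simp: M46_def cong_def)
qed

text \<open>Since 4 is 1 mod 3, splitting it off preserves the residue mod 3; the third factor 2
  keeps the cofactor even.\<close>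

lemma atom_not_dvd_8:
  assumes "u \<in> atoms46"
  shows "\<not> 8 dvd u"
proof
  assume "8 dvd u"
  then obtain k where k: "u = 8 * k" ..
  have "u \<in> M46" "u \<noteq> 1" using assms by (auto simp: atoms46_def)
  then have "(8 * k) mod 3 = 1" using k by (auto simp: M46_iff)
  then have "(2 * k) mod 3 = 1" by presburger
  then have "2 * k \<in> M46 - {1}" by (auto simp: M46_iff)
  moreover have "4 \<in> M46 - {1}" by (simp add: M46_iff)
  moreover have "u = 4 * (2 * k)" using k by simp
  ultimately show False using assms unfolding atoms46_def by blast
qed

text \<open>Elements of the monoid other than 1 are even, so a product of two of them is divisible
  by 4.\<close>

lemma atomI:
  assumes "u \<in> M46" "u \<noteq> 1" "\<not> 4 dvd u"
  shows "u \<in> atoms46"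
proof -
  have "4 dvd a * b" if "a \<in> M46 - {1}" "b \<in> M46 - {1}" for a b
    using mult_dvd_mono [of 2 a 2 b] that by (auto simp: M46_iff)
  then show ?thesis using assms by (auto simp: atoms46_def)
qed

text \<open>Modulo 3, both 2 and 5 are -1 and 7 is 1, so the residue is the sign given by the parity
  of \<open>p + q\<close>.\<close>

lemma prime_power_product_in_M46:
  assumes "p > 0" "even (p + q)"
  shows "2 ^ p * 5 ^ q * 7 ^ s \<in> M46"
proof -
  have "[2 ^ p * 5 ^ q * 7 ^ s = 2 ^ p * 2 ^ q * 1 ^ s] (mod 3 :: nat)"
    by (intro cong_mult cong_pow cong_refl) (auto simp: cong_def)
  moreover obtain k where "p + q = 2 * k" using assms by blast
  then have "2 ^ p * 2 ^ q = (4 :: nat) ^ k" by (simp add: power_add [symmetric] power_mult)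
  moreover have "[4 ^ k = 1 ^ k] (mod 3 :: nat)"
    by (intro cong_pow) (simp add: cong_def)
  ultimately have "[2 ^ p * 5 ^ q * 7 ^ s = 1] (mod 3 :: nat)"
    using cong_trans by fastforce
  then show ?thesis using assms by (simp add: M46_iff cong_def)
qed

lemma atom_odd_power_5: "2 * 5 ^ (2 * i + 1) * 7 ^ j \<in> atoms46"
proof (rule atomI)
  show "2 * 5 ^ (2 * i + 1) * 7 ^ j \<in> M46"
    using prime_power_product_in_M46 [of 1 "2 * i + 1" j] by simp
  \<comment> \<open>With the odd part named, both remaining goals are linear arithmetic about
    \<open>2 * k\<close>.\<close>
  define k :: nat where "k = 5 ^ (2 * i + 1) * 7 ^ j"
  have "odd k" by (simp add: k_def)
  moreover have "2 * 5 ^ (2 * i + 1) * 7 ^ j = 2 * k" by (simp only: k_def mult.assoc)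
  ultimately show "\<not> 4 dvd (2 * 5 ^ (2 * i + 1) * 7 ^ j :: nat)"
    and "2 * 5 ^ (2 * i + 1) * 7 ^ j \<noteq> (1 :: nat)" by presburger+
qed

section \<open>Exponents of divisors of powers of 70\<close>

text \<open>Every prime factor of \<open>u\<close> divides 70. This makes the triple of exponents
  determine the divisor.\<close>

lemma dvd_power_70_eq:
  fixes u :: nat
  assumes "u dvd 70 ^ n"
  shows "u = 2 ^ multiplicity 2 u * 5 ^ multiplicity 5 u * 7 ^ multiplicity 7 u"
proof -
  have "u \<noteq> 0" using assms by (metis dvd_0_left_iff power_eq_0_iff zero_neq_numeral)
  have "p \<in> {2, 5, 7}" if "p \<in> prime_factors u" for p
  proof -
    have p: "prime p" "p dvd u" using that by auto
    then have "p dvd 70 ^ n" using assms by (blast intro: dvd_trans)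
    then have "p dvd 2 * 5 * 7" using prime_dvd_power [OF p(1)] by simp
    then have "p dvd 2 \<or> p dvd 5 \<or> p dvd 7"
      using p by (simp only: prime_dvd_mult_iff disj_assoc)
    then show ?thesis using p primes_dvd_imp_eq [of p] by auto
  qed
  then have "prime_factors u \<subseteq> {2, 5, 7}" by blast
  then have "(\<Prod>p\<in>prime_factors u. p ^ multiplicity p u) = (\<Prod>p\<in>{2, 5, 7}. p ^ multiplicity p u)"
    by (intro prod.mono_neutral_left) (auto simp: prime_factors_multiplicity)
  then have "u = (\<Prod>p\<in>{2, 5, 7}. p ^ multiplicity p u)"
    using prime_factorization_nat [of u] \<open>u \<noteq> 0\<close> by (metis neq0_conv)
  then show ?thesis by (simp add: mult.assoc [symmetric])
qed

lemma multiplicity_power_70: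
  assumes "p \<in> {2, 5, 7 :: nat}"
  shows "multiplicity p (70 ^ n) = n"
proof -
  have "multiplicity p (2 ^ n * 5 ^ n * 7 ^ n) = n" using assms
    by (auto simp: prime_elem_multiplicity_mult_distrib multiplicity_distinct_prime_power)
  moreover have "2 ^ n * 5 ^ n * 7 ^ n = (70 :: nat) ^ n"
    by (simp only: power_mult_distrib [symmetric]) simp
  ultimately show ?thesis by simp
qed

lemma sum_multiplicity_le:
  assumes "\<Prod>S dvd 70 ^ n" "p \<in> {2, 5, 7 :: nat}"
  shows "(\<Sum>u\<in>S. multiplicity p u) \<le> n"
proof (cases "finite S")
  case True
  have "\<Prod>S \<noteq> 0" using assms by (metis dvd_0_left_iff power_eq_0_iff zero_neq_numeral)
  then have "(\<Sum>u\<in>S. multiplicity p u) = multiplicity p (\<Prod>S)"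
    using True assms by (subst prime_elem_multiplicity_prod_distrib) auto
  also have "\<dots> \<le> multiplicity p (70 ^ n)"
    using assms(1) by (intro dvd_imp_multiplicity_le) auto
  finally show ?thesis using assms by (simp add: multiplicity_power_70)
\<comment> \<open>For infinite \<open>S\<close> the sum is 0 by convention.\<close>
qed simp

text \<open>Markov's inequality: each counted element contributes at least \<open>t\<close> to a sum
  that is at most \<open>n\<close>.\<close>

lemma card_multiplicity_ge:
  assumes "finite S" "\<Prod>S dvd 70 ^ n" "p \<in> {2, 5, 7 :: nat}"
  shows "t * card {u \<in> S. multiplicity p u \<ge> t} \<le> n"
proof -
  have "t * card {u \<in> S. multiplicity p u \<ge> t} = (\<Sum>u | u \<in> S \<and> multiplicity p u \<ge> t. t)"
    by simp
  also have "\<dots> \<le> (\<Sum>u | u \<in> S \<and> multiplicity p u \<ge> t. multiplicity p u)"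
    by (rule sum_mono) auto
  also have "\<dots> \<le> (\<Sum>u\<in>S. multiplicity p u)"
    using assms by (intro sum_mono2) auto
  finally show ?thesis using sum_multiplicity_le [OF assms(2,3)] by simp
qed

section \<open>Upper bound\<close>

text \<open>The exponent triples are distinct and lie in a box; its side for the prime 2 is 3
  because 8 divides no atom.\<close>

lemma card_small_atoms:
  assumes "S \<subseteq> atoms46" "\<And>u. u \<in> S \<Longrightarrow> u dvd 70 ^ n"
    "\<And>u. u \<in> S \<Longrightarrow> multiplicity 5 u < t \<and> multiplicity 7 u < t"
  shows "card S \<le> 3 * t ^ 2"
proof -
  have "multiplicity 2 u < 3" if "u \<in> S" for u
  proof (rule ccontr)
    assume "\<not> multiplicity 2 u < 3"
    then have "2 ^ 3 dvd u" by (intro multiplicity_dvd') auto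
    then show False using atom_not_dvd_8 assms(1) that by auto
  qed
  moreover have "inj_on (\<lambda>u. (multiplicity 2 u, multiplicity 5 u, multiplicity 7 u)) S"
  proof (rule inj_onI)
    fix u v assume "u \<in> S" "v \<in> S"
      "(multiplicity 2 u, multiplicity 5 u, multiplicity 7 u) =
        (multiplicity 2 v, multiplicity 5 v, multiplicity 7 v)"
    then show "u = v" using dvd_power_70_eq [of u n] dvd_power_70_eq [of v n] assms(2) by simp
  qed
  ultimately have "card S \<le> card ({..<3::nat} \<times> {..<t} \<times> {..<t})"
    using assms by (intro card_inj_on_le) auto
  then show ?thesis by (simp add: power2_eq_square)
qed

lemma card_atoms_dvd_power_70:
  assumes S: "finite S" "S \<subseteq> atoms46" "\<Prod>S dvd 70 ^ n"
  shows "t * card S \<le> 3 * t ^ 3 + 2 * n"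
proof -
  define A where "A = {u \<in> S. multiplicity 5 u < t \<and> multiplicity 7 u < t}"
  define B where "B p = {u \<in> S. multiplicity p u \<ge> t}" for p
  have "u dvd 70 ^ n" if "u \<in> S" for u
    using dvd_prodI [of S u "\<lambda>u. u"] S that dvd_trans by blast
  then have A: "card A \<le> 3 * t ^ 2"
    using S by (intro card_small_atoms) (auto simp: A_def)
  have "S = A \<union> (B 5 \<union> B 7)" by (auto simp: A_def B_def)
  then have "card S \<le> card A + (card (B 5) + card (B 7))"
    by (metis card_Un_le add_left_mono le_trans)
  then have "t * card S \<le> t * card A + (t * card (B 5) + t * card (B 7))"
    by (metis distrib_left mult_le_mono2)
  moreover have "t * card A \<le> 3 * t ^ 3"
    using mult_le_mono2 [OF A, of t] by (simp add: power3_eq_cube power2_eq_square mult_ac)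
  moreover have "t * card (B 5) \<le> n" "t * card (B 7) \<le> n"
    using S unfolding B_def by (intro card_multiplicity_ge; simp)+
  ultimately show ?thesis by linarith
qed

lemma ell0_max_power_70_upper: "t * ell0_max (70 ^ n) \<le> 3 * t ^ 3 + 2 * n"
proof -
  have "70 ^ n \<in> M46"
    by (induction n) (auto simp: M46_iff [of "Suc 0"] intro: mult_in_M46 seventy_in_M46)
  then have "ell0_max (70 ^ n) \<in> ell0 ` factorization_tuples (70 ^ n)"
    unfolding ell0_max_def
    by (intro Max_in finite_ell0_image) (simp add: factorization_tuples_nonempty)
  then obtain z where z: "z \<in> factorization_tuples (70 ^ n)" "ell0_max (70 ^ n) = ell0 z"
    by blast
  from z(1) obtain S f where S: "finite S" "S \<subseteq> atoms46" "card S = ell0 z"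
    and f: "\<And>u. u \<in> S \<Longrightarrow> f u > (0::nat)" and eq: "70 ^ n = (\<Prod>u\<in>S. u ^ f u)"
    by (rule factorization_tuplesE) (rule that)
  \<comment> \<open>All exponents are positive, so lowering each to 1 yields a divisor.\<close>
  have "\<Prod>S dvd 70 ^ n"
    unfolding eq by (rule prod_dvd_prod) (use f in \<open>auto intro: dvd_power\<close>)
  then show ?thesis using card_atoms_dvd_power_70 [OF S(1,2)] S z by simp
qed

section \<open>Lower bound\<close>

lemma ell0_max_power_70_lower:
  assumes "2 \<le> m" "m ^ 3 \<le> n"
  shows "m ^ 2 \<le> ell0_max (70 ^ n)"
proof -
  define I where "I = {..<m} \<times> {..<m}"
  define u :: "nat \<times> nat \<Rightarrow> nat" where "u = (\<lambda>(i, j). 2 * 5 ^ (2 * i + 1) * 7 ^ j)"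
  have mult_u: "multiplicity 5 (u (i, j)) = 2 * i + 1" "multiplicity 7 (u (i, j)) = j" for i j
  proof -
    show "multiplicity 5 (u (i, j)) = 2 * i + 1"
      by (simp add: u_def prime_elem_multiplicity_mult_distrib multiplicity_distinct_prime_power
          not_dvd_imp_multiplicity_0 del: power_Suc)
    show "multiplicity 7 (u (i, j)) = j"
      by (simp add: u_def prime_elem_multiplicity_mult_distrib multiplicity_distinct_prime_power
          not_dvd_imp_multiplicity_0 del: power_Suc)
  qed
  have inj: "inj_on u I"
  proof (rule inj_onI, clarify)
    fix i j i' j' assume "u (i, j) = u (i', j')"
    then show "i = i' \<and> j = j'" using mult_u [of i j] mult_u [of i' j'] by simp
  qed
  \<comment> \<open>This is the exponent of 7 in the product of the chosen atoms; the crude bound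
    \<open>m ^ 3\<close> suffices.\<close>
  define s where "s = (\<Sum>i<m. \<Sum>j<m. j)"
  have "s \<le> (\<Sum>i<m. \<Sum>j<m. m)" unfolding s_def by (intro sum_mono) auto
  then have s: "s \<le> n" using assms by (simp add: power3_eq_cube mult_ac)
  have odds: "(\<Sum>i<m. 2 * i + 1) = m ^ 2"
    by (induction m) (auto simp: power2_eq_square)
  \<comment> \<open>Strictness leaves the cofactor \<open>r\<close> a positive power of 2, as
    membership in the monoid demands.\<close>
  have m23: "m ^ 2 < m ^ 3" using assms by (intro power_strict_increasing) auto
  have "\<Prod>(u ` I) = (\<Prod>i<m. \<Prod>j<m. 2 * 5 ^ (2 * i + 1) * 7 ^ j)"
    unfolding prod.reindex [OF inj] by (simp add: I_def u_def prod.cartesian_product comp_def split_def)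
  also have "\<dots> = (\<Prod>i<m. \<Prod>j<m. 2) * (\<Prod>i<m. \<Prod>j<m. 5 ^ (2 * i + 1)) * (\<Prod>i<m. \<Prod>j<m. 7 ^ j)"
    by (simp only: prod.distrib)
  also have "\<dots> = 2 ^ (m ^ 2) * 5 ^ (\<Sum>i<m. (2 * i + 1) * m) * 7 ^ s"
    by (simp only: s_def power_sum prod_constant card_lessThan power_mult [symmetric] power2_eq_square)
  also have "(\<Sum>i<m. (2 * i + 1) * m) = m ^ 3"
    by (simp only: odds sum_distrib_right [symmetric]) (simp add: power3_eq_cube power2_eq_square)
  finally have P: "\<Prod>(u ` I) = 2 ^ (m ^ 2) * 5 ^ (m ^ 3) * 7 ^ s" .
  define r :: nat where "r = 2 ^ (n - m ^ 2) * 5 ^ (n - m ^ 3) * 7 ^ (n - s)"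
  have "\<Prod>(u ` I) * r = 2 ^ (m ^ 2 + (n - m ^ 2)) * 5 ^ (m ^ 3 + (n - m ^ 3)) * 7 ^ (s + (n - s))"
    unfolding P r_def by (simp only: power_add mult_ac)
  also have "\<dots> = 70 ^ n"
  proof -
    have "m ^ 2 + (n - m ^ 2) = n" "m ^ 3 + (n - m ^ 3) = n" "s + (n - s) = n"
      using assms m23 s by linarith+
    then show ?thesis by (simp only: power_mult_distrib [symmetric]) simp
  qed
  finally have eq: "\<Prod>(u ` I) * r = 70 ^ n" .
  \<comment> \<open>The exponents of 2 and 5 in \<open>r\<close> add up to
    \<open>2 * n - (m ^ 2 + m ^ 3)\<close>, which is therefore even.\<close>
  have "even (m ^ 2 + m ^ 3)" by simp
  then have "r \<in> M46"
    unfolding r_def using assms m23 by (intro prime_power_product_in_M46) presburger+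
  moreover have "u ` I \<subseteq> atoms46" using atom_odd_power_5 by (auto simp: u_def)
  moreover have "finite (u ` I)" by (simp add: I_def)
  ultimately have "card (u ` I) \<le> ell0_max (70 ^ n)"
    using card_le_ell0_max_mult eq by metis
  then show ?thesis
    unfolding card_image [OF inj] by (simp add: I_def power2_eq_square)
qed

theorem proposition3p7:
  fixes x :: nat
  assumes "x = 70"
  shows "(\<lambda>n::nat. real (ell0_max (x ^ n))) \<in> \<Theta>(\<lambda>n. real n powr (2 / 3))"
proof -
  \<comment> \<open>The threshold 8 gives a cube root of at least 2, so its floor \<open>m\<close>
    is admissible in the lower bound.\<close>
  have bounds: "1 / 4 * real n powr (2 / 3) \<le> real (ell0_max (70 ^ n)) \<and>
      real (ell0_max (70 ^ n)) \<le> 14 * real n powr (2 / 3)" if "n \<ge> 8" for n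
  proof -
    define y where "y = real n powr (1 / 3)"
    have y3: "y ^ 3 = real n"
      using that by (simp add: y_def powr_power)
    have y2: "y ^ 2 = real n powr (2 / 3)"
      using that by (simp add: y_def powr_power)
    have y: "y \<ge> 2"
    proof (rule ccontr)
      assume "\<not> y \<ge> 2"
      then have "y ^ 3 < 2 ^ 3" by (intro power_strict_mono) (auto simp: y_def)
      then show False using y3 that by simp
    qed
    define m where "m = nat \<lfloor>y\<rfloor>"
    have m: "real m \<le> y" "y < real m + 1" "2 \<le> m"
      using y by (auto simp: m_def le_nat_iff le_floor_iff)
    have "real m ^ 3 \<le> y ^ 3" using m by (intro power_mono) auto
    then have "real (m ^ 3) \<le> real n" using y3 by simp
    then have "m ^ 3 \<le> n" by (simp only: of_nat_le_iff)
    then have "m ^ 2 \<le> ell0_max (70 ^ n)"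
      by (rule ell0_max_power_70_lower [OF m(3)])
    then have "real m ^ 2 \<le> real (ell0_max (70 ^ n))"
      by (metis of_nat_le_iff of_nat_power)
    \<comment> \<open>The floor loses at most half of \<open>y\<close>; squaring gives the constant
      1/4.\<close>
    moreover have "(y / 2) ^ 2 \<le> real m ^ 2"
      using m y by (intro power_mono) auto
    moreover have "(y / 2) ^ 2 = 1 / 4 * y ^ 2" by (simp add: power_divide)
    ultimately have lower: "1 / 4 * y ^ 2 \<le> real (ell0_max (70 ^ n))"
      by linarith
    let ?t = "real (m + 1)" and ?L = "real (ell0_max (70 ^ n))"
    have "real ((m + 1) * ell0_max (70 ^ n)) \<le> real (3 * (m + 1) ^ 3 + 2 * n)"
      using ell0_max_power_70_upper by (subst of_nat_le_iff)
    then have "?t * ?L \<le> 3 * ?t ^ 3 + 2 * y ^ 3"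
      by (simp only: y3 of_nat_mult of_nat_add of_nat_power of_nat_numeral)
    \<comment> \<open>The choice \<open>t = m + 1\<close> exceeds \<open>y\<close>, so a factor
      \<open>t\<close> can be cancelled. With \<open>t\<close> at most \<open>2 * y\<close>, the
      constant becomes 3 * 4 + 2 = 14.\<close>
    also have "y ^ 3 \<le> ?t * y ^ 2"
      using m y by (simp add: power3_eq_cube power2_eq_square mult_right_mono)
    finally have "?t * ?L \<le> ?t * (3 * ?t ^ 2 + 2 * y ^ 2)"
      by (simp add: power3_eq_cube power2_eq_square algebra_simps)
    then have "?L \<le> 3 * ?t ^ 2 + 2 * y ^ 2" by (rule mult_left_le_imp_le) simp
    also have "?t ^ 2 \<le> (2 * y) ^ 2" using m y by (intro power_mono) auto
    finally have "?L \<le> 14 * y ^ 2" by (simp add: power_mult_distrib)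
    with lower show ?thesis by (simp add: y2)
  qed
  show ?thesis
    unfolding assms
  proof (rule bigthetaI')
    show "eventually (\<lambda>n. 1 / 4 * norm (real n powr (2 / 3)) \<le> norm (real (ell0_max (70 ^ n))) \<and>
        norm (real (ell0_max (70 ^ n))) \<le> 14 * norm (real n powr (2 / 3))) sequentially"
      using eventually_ge_at_top [of 8] by eventually_elim (use bounds in auto)
  qed auto
qed

end
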